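(* The variety of binary symmetric Zinbiel algebras over $\mathbb{C}$ is defined by the identities $$x(yx)=(xy+yx)x,\qquad x(xy)=2x^2y,\qquad (xy)x=x(yx+xy),\qquad (yx)x=2yx^2.$$
   Context: Algebras are over $\mathbb{C}$ and not assumed associative; $x^2=xx$. An algebra is symmetric Zinbiel if $(xy)z=x(yz)+x(zy)$ and $x(yz)=(xy)z+(yx)z$ for all $x,y,z$. For a variety $\Omega$ of algebras, an algebra is called binary-$\Omega$ if each of its two-generated subalgebras (subalgebras generated by two elements) belongs to $\Omega$. *)

theory Defs
  imports Complex_Main
begin

(* An arbitrary (nonassociative, nonunital) algebra over the complex numbers, carried by a
   whole type. *)
locale complex_algebra = vector_space scale
  for scale :: "complex \<Rightarrow> 'a::ab_group_add \<Rightarrow> 'a" +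
  fixes mult :: "'a \<Rightarrow> 'a \<Rightarrow> 'a"  (infixl \<open>\<cdot>\<close> 70)
  assumes linear_mult_left: "Vector_Spaces.linear scale scale (\<lambda>x. x \<cdot> y)"
    and linear_mult_right: "Vector_Spaces.linear scale scale (\<lambda>y. x \<cdot> y)"
begin

definition subalgebra :: "'a set \<Rightarrow> bool" where
  "subalgebra S \<longleftrightarrow> subspace S \<and> (\<forall>x\<in>S. \<forall>y\<in>S. x \<cdot> y \<in> S)"

definition generated_subalgebra :: "'a set \<Rightarrow> 'a set" where
  "generated_subalgebra X = subalgebra hull X"

(* To be used for a subalgebra S, viewed as an algebra with the inherited operations. *)
definition symmetric_Zinbiel :: "'a set \<Rightarrow> bool" where
  "symmetric_Zinbiel S \<longleftrightarrow>
     (\<forall>x\<in>S. \<forall>y\<in>S. \<forall>z\<in>S.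
        (x \<cdot> y) \<cdot> z = x \<cdot> (y \<cdot> z) + x \<cdot> (z \<cdot> y) \<and>
        x \<cdot> (y \<cdot> z) = (x \<cdot> y) \<cdot> z + (y \<cdot> x) \<cdot> z)"

(* Omega says of a subalgebra that it belongs to the given variety. The generators a and b
   are allowed to coincide. *)
definition binary :: "('a set \<Rightarrow> bool) \<Rightarrow> bool" where
  "binary \<Omega> \<longleftrightarrow> (\<forall>a b. \<Omega> (generated_subalgebra {a, b}))"

definition binary_symmetric_Zinbiel :: bool where
  "binary_symmetric_Zinbiel \<longleftrightarrow> binary symmetric_Zinbiel"

end

end

theory Submission
  imports Defs
begin

text \<open>
  The four identities are instances of the symmetric Zinbiel identities with two equal arguments,
  so they hold in every binary symmetric Zinbiel algebra. Conversely, polarising them shows that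
  every product of \<open>x, x, y\<close> is an integer multiple of \<open>x\<^sup>2y\<close>, and that
  the symmetric Zinbiel identities hold whenever two arguments coincide. Evaluating products of
  four generators in several ways shows that they all vanish. Hence the subalgebra generated by
  \<open>a, b\<close> is spanned by \<open>a, b, a\<^sup>2, ab, ba, b\<^sup>2, a\<^sup>2b, b\<^sup>2a\<close>; on these vectors the
  identities are trivial in degree at least four, and in degree three two arguments coincide.
\<close>

context complex_algebra
begin

section \<open>Bilinearity, and cancellation of 2 and 3\<close>

lemma mult_add_left: "(x + y) \<cdot> z = x \<cdot> z + y \<cdot> z"
  using linear_mult_left[of z] by (simp add: Vector_Spaces.linear_iff)

lemma mult_add_right: "z \<cdot> (x + y) = z \<cdot> x + z \<cdot> y"
  using linear_mult_right[of z] by (simp add: Vector_Spaces.linear_iff)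

lemma mult_scale_left: "scale c x \<cdot> z = scale c (x \<cdot> z)"
  using linear_mult_left[of z] by (simp add: Vector_Spaces.linear_iff)

lemma mult_scale_right: "z \<cdot> scale c x = scale c (z \<cdot> x)"
  using linear_mult_right[of z] by (simp add: Vector_Spaces.linear_iff)

lemma mult_zero_left [simp]: "0 \<cdot> z = 0"
  using mult_add_left[of 0 0 z] by simp

lemma mult_zero_right [simp]: "z \<cdot> 0 = 0"
  using mult_add_right[of z 0 0] by simp

lemma mult_minus_left: "(- x) \<cdot> z = - (x \<cdot> z)"
  using mult_add_left[of "- x" x z] by (simp add: eq_neg_iff_add_eq_0)

lemma mult_minus_right: "z \<cdot> (- x) = - (z \<cdot> x)"
  using mult_add_right[of z "- x" x] by (simp add: eq_neg_iff_add_eq_0)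

lemma mult_diff_left: "(x - y) \<cdot> z = x \<cdot> z - y \<cdot> z"
  using mult_add_left[of x "- y" z] by (simp add: mult_minus_left)

lemma mult_diff_right: "z \<cdot> (x - y) = z \<cdot> x - z \<cdot> y"
  using mult_add_right[of z x "- y"] by (simp add: mult_minus_right)

lemmas mult_linear_simps =
  mult_add_left mult_add_right mult_minus_left mult_minus_right mult_diff_left mult_diff_right

lemma scale_two: "scale 2 x = x + x"
  using scale_left_distrib[of 1 1 x] by simp

lemma scale_three: "scale 3 x = x + x + x"
  using scale_left_distrib[of 2 1 x] by (simp add: scale_two)

lemma double_eq_iff: "(x::'a) + x = y + y \<longleftrightarrow> x = y"
  using scale_cancel_left[of 2 x y] by (simp add: scale_two)

lemma triple_eq_0_iff: "(x::'a) + x + x = 0 \<longleftrightarrow> x = 0"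
  using scale_eq_0_iff[of 3 x] by (simp add: scale_three)

lemma double_eq_0_iff: "(x::'a) + x = 0 \<longleftrightarrow> x = 0"
  using double_eq_iff[of x 0] by (simp only: add_0_left)

lemma double_eq_minus_iff: "(x::'a) + x = - x \<longleftrightarrow> x = 0"
  using triple_eq_0_iff[of x] by (simp only: eq_neg_iff_add_eq_0)

section \<open>Generated subalgebras and passage to spans\<close>

lemma generated_subalgebra_superset: "X \<subseteq> generated_subalgebra X"
  unfolding generated_subalgebra_def by (rule hull_subset)

lemma generated_subalgebra_minimal:
  "X \<subseteq> S \<Longrightarrow> subalgebra S \<Longrightarrow> generated_subalgebra X \<subseteq> S"
  unfolding generated_subalgebra_def by (rule hull_minimal)

lemma symmetric_Zinbiel_subset: "symmetric_Zinbiel S \<Longrightarrow> T \<subseteq> S \<Longrightarrow> symmetric_Zinbiel T"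
  unfolding symmetric_Zinbiel_def by blast

text \<open>Bilinearity lets closure be tested on spanning vectors; the two inductions extend it to
  one factor at a time.\<close>

lemma subalgebra_span:
  assumes "\<And>x y. x \<in> B \<Longrightarrow> y \<in> B \<Longrightarrow> x \<cdot> y \<in> span B"
  shows "subalgebra (span B)"
  unfolding subalgebra_def
proof (intro conjI ballI)
  fix x y assume x: "x \<in> span B" and y: "y \<in> span B"
  have *: "x \<cdot> z \<in> span B" if "z \<in> B" for z
  proof (rule span_induct[OF x])
    show "subspace {u. u \<cdot> z \<in> span B}"
      by (rule subspaceI) (simp_all add: mult_add_left mult_scale_left span_add span_scale span_zero)
  qed (rule assms, use that in auto)
  show "x \<cdot> y \<in> span B"
  proof (rule span_induct[OF y])
    show "subspace {v. x \<cdot> v \<in> span B}"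
      by (rule subspaceI)
        (simp_all add: mult_add_right mult_scale_right span_add span_scale span_zero)
  qed (rule *)
qed simp

text \<open>Both identities are linear in each of the three arguments, so for two fixed arguments
  the solutions in the third form a subspace. The arguments are released from \<open>B\<close> to
  \<open>span B\<close> one after another.\<close>

lemma symmetric_Zinbiel_span:
  assumes "symmetric_Zinbiel B"
  shows "symmetric_Zinbiel (span B)"
proof -
  let ?L = "\<lambda>x y z. (x \<cdot> y) \<cdot> z = x \<cdot> (y \<cdot> z) + x \<cdot> (z \<cdot> y)"
  let ?R = "\<lambda>x y z. x \<cdot> (y \<cdot> z) = (x \<cdot> y) \<cdot> z + (y \<cdot> x) \<cdot> z"
  let ?P = "\<lambda>x y z. ?L x y z \<and> ?R x y z"
  have L: "subspace {x. ?L x y z}" "subspace {y. ?L x y z}" "subspace {z. ?L x y z}" for x y z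
    by (rule subspaceI; simp add: mult_linear_simps mult_scale_left mult_scale_right
        scale_right_distrib add_ac)+
  have R: "subspace {x. ?R x y z}" "subspace {y. ?R x y z}" "subspace {z. ?R x y z}" for x y z
    by (rule subspaceI; simp add: mult_linear_simps mult_scale_left mult_scale_right
        scale_right_distrib add_ac)+
  have sub: "subspace {x. ?P x y z}" "subspace {y. ?P x y z}" "subspace {z. ?P x y z}" for x y z
    by (simp_all only: Collect_conj_eq subspace_inter L R)
  have 1: "?P x y z" if "x \<in> span B" "y \<in> B" "z \<in> B" for x y z
    using that(1) by (rule span_induct[OF _ sub(1)])
      (use assms that in \<open>unfold symmetric_Zinbiel_def, blast\<close>)
  have 2: "?P x y z" if "x \<in> span B" "y \<in> span B" "z \<in> B" for x y z
    using that(2) by (rule span_induct[OF _ sub(2)]) (use 1 that in blast)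
  have 3: "?P x y z" if "x \<in> span B" "y \<in> span B" "z \<in> span B" for x y z
    using that(3) by (rule span_induct[OF _ sub(3)]) (use 2 that in blast)
  then show ?thesis
    unfolding symmetric_Zinbiel_def by blast
qed

end

section \<open>Consequences of the four identities in degree three\<close>

locale two_variable_Zinbiel = complex_algebra +
  assumes left_flexible: "x \<cdot> (y \<cdot> x) = (x \<cdot> y + y \<cdot> x) \<cdot> x"
    and left_alternative: "x \<cdot> (x \<cdot> y) = scale 2 ((x \<cdot> x) \<cdot> y)"
    and right_flexible: "(x \<cdot> y) \<cdot> x = x \<cdot> (y \<cdot> x + x \<cdot> y)"
    and right_alternative: "(y \<cdot> x) \<cdot> x = scale 2 (y \<cdot> (x \<cdot> x))"
begin

lemma mult_x_xy: "x \<cdot> (x \<cdot> y) = (x \<cdot> x) \<cdot> y + (x \<cdot> x) \<cdot> y"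
  by (simp add: left_alternative scale_two)

lemma mult_yx_x: "(y \<cdot> x) \<cdot> x = - ((x \<cdot> x) \<cdot> y + (x \<cdot> x) \<cdot> y)"
proof -
  \<comment> \<open>Adding the two flexible identities cancels
    \<open>x \<cdot> (y \<cdot> x)\<close> and \<open>(x \<cdot> y) \<cdot> x\<close>.\<close>
  have "(y \<cdot> x) \<cdot> x + x \<cdot> (x \<cdot> y) = 0"
    using left_flexible[of x y] right_flexible[of x y]
    by (simp add: mult_linear_simps algebra_simps)
  then show ?thesis
    by (simp only: mult_x_xy eq_neg_iff_add_eq_0)
qed

lemma mult_y_xx: "y \<cdot> (x \<cdot> x) = - ((x \<cdot> x) \<cdot> y)"
proof -
  have "y \<cdot> (x \<cdot> x) + y \<cdot> (x \<cdot> x) = - ((x \<cdot> x) \<cdot> y) + - ((x \<cdot> x) \<cdot> y)"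
    using right_alternative[of y x] mult_yx_x[of y x] by (simp add: scale_two)
  then show ?thesis
    by (simp only: double_eq_iff)
qed

lemma left_flexible_polarised:
  "x \<cdot> (y \<cdot> z) + z \<cdot> (y \<cdot> x) = (x \<cdot> y + y \<cdot> x) \<cdot> z + (z \<cdot> y + y \<cdot> z) \<cdot> x"
  using left_flexible[of "x + z" y] left_flexible[of x y] left_flexible[of z y]
  by (simp add: mult_linear_simps algebra_simps)

text \<open>In this instance of the polarised identity \<open>(x \<cdot> y) \<cdot> x\<close> is the
  only product not yet expressed through \<open>(x \<cdot> x) \<cdot> y\<close>.\<close>

lemma mult_xy_x: "(x \<cdot> y) \<cdot> x = (x \<cdot> x) \<cdot> y"
  using left_flexible_polarised[of x x y]
  by (simp add: mult_linear_simps mult_x_xy mult_y_xx mult_yx_x algebra_simps)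

lemma mult_x_yx: "x \<cdot> (y \<cdot> x) = - ((x \<cdot> x) \<cdot> y)"
  using left_flexible[of x y] by (simp add: mult_linear_simps mult_xy_x mult_yx_x)

lemmas mult_two_variables = mult_x_xy mult_yx_x mult_y_xx mult_xy_x mult_x_yx

text \<open>For \<open>y = x\<close> two rules evaluate \<open>x \<cdot> (x \<cdot> x)\<close>, as 2
  and as -1 times \<open>(x \<cdot> x) \<cdot> x\<close>, so 3 times the cube vanishes.\<close>

lemma cube_left: "(x \<cdot> x) \<cdot> x = 0"
  using mult_x_xy[of x x] mult_y_xx[of x x] double_eq_minus_iff[of "(x \<cdot> x) \<cdot> x"] by metis

lemma cube_right: "x \<cdot> (x \<cdot> x) = 0"
  using mult_y_xx[of x x] by (simp add: cube_left)

section \<open>Vanishing of products of degree four or more\<close>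

lemma mult_xy_x_polarised: "(x \<cdot> y) \<cdot> z + (z \<cdot> y) \<cdot> x = (x \<cdot> z + z \<cdot> x) \<cdot> y"
  using mult_xy_x[of "x + z" y] mult_xy_x[of x y] mult_xy_x[of z y]
  by (simp add: mult_linear_simps algebra_simps)

lemma mult_x_yx_polarised: "x \<cdot> (y \<cdot> z) + z \<cdot> (y \<cdot> x) = - ((x \<cdot> z + z \<cdot> x) \<cdot> y)"
  using mult_x_yx[of "x + z" y] mult_x_yx[of x y] mult_x_yx[of z y]
  by (simp add: mult_linear_simps eq_neg_iff_add_eq_0 add_ac)

text \<open>Serves to trade a product with \<open>p \<cdot> q\<close> for products in which
  \<open>w\<close> meets \<open>p\<close> and \<open>q\<close> one at a time.\<close>

lemma mult_mult_eq_0: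
  assumes "(w \<cdot> q) \<cdot> p = 0" "(p \<cdot> w) \<cdot> q = 0" "(w \<cdot> p) \<cdot> q = 0"
  shows "(p \<cdot> q) \<cdot> w = 0"
  using mult_xy_x_polarised[of p q w] assms by (simp add: mult_linear_simps)

lemma mult_mult_eq_0':
  assumes "q \<cdot> (p \<cdot> w) = 0" "(q \<cdot> w) \<cdot> p = 0" "(w \<cdot> q) \<cdot> p = 0"
  shows "w \<cdot> (p \<cdot> q) = 0"
  using mult_x_yx_polarised[of q p w] assms by (simp add: mult_linear_simps)

text \<open>Putting \<open>x \<cdot> y\<close> for \<open>y\<close> in two degree three rules gives
  \<open>?v = -2 ?U\<close> and \<open>2 ?v = ?U\<close>, hence \<open>5 ?v = 0\<close>.\<close>

lemma mult_xxy_x: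
  shows "x \<cdot> ((x \<cdot> x) \<cdot> y) = 0" and "((x \<cdot> x) \<cdot> y) \<cdot> x = 0"
proof -
  let ?v = "((x \<cdot> x) \<cdot> y) \<cdot> x" and ?U = "(x \<cdot> x) \<cdot> (x \<cdot> y)"
  have "?v = - (?U + ?U)"
    using mult_yx_x[of "x \<cdot> y" x] by (simp add: mult_xy_x)
  moreover have "?v + ?v = ?U"
    using mult_xy_x[of x "x \<cdot> y"] by (simp add: mult_x_xy mult_linear_simps)
  ultimately have "?v = - (?v + ?v + (?v + ?v))"
    by simp
  then have "(?v + ?v) + (?v + ?v) = - ?v"
    by (metis minus_minus)
  then have "scale 5 ?v = 0"
    using scale_left_distrib[of 4 1 ?v] scale_left_distrib[of 2 2 ?v]
    by (simp add: scale_two)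
  then show v: "?v = 0"
    by simp
  then have "?U = 0"
    using \<open>?v + ?v = ?U\<close> by simp
  then have "x \<cdot> ((x \<cdot> x) \<cdot> y) + x \<cdot> ((x \<cdot> x) \<cdot> y) = 0"
    using mult_x_xy[of x "x \<cdot> y"] by (simp add: mult_x_xy mult_linear_simps)
  then show "x \<cdot> ((x \<cdot> x) \<cdot> y) = 0"
    by (simp add: double_eq_0_iff)
qed

text \<open>Here the rules are applied with \<open>y\<close> as the repeated letter and
  \<open>x \<cdot> x\<close> as the other one. They give \<open>?v = -2 ?U\<close> and
  \<open>?v = - ?U\<close>.\<close>

lemma mult_xxy_y:
  shows "y \<cdot> ((x \<cdot> x) \<cdot> y) = 0" and "((x \<cdot> x) \<cdot> y) \<cdot> y = 0"
proof -
  let ?v = "((x \<cdot> x) \<cdot> y) \<cdot> y" and ?U = "(y \<cdot> y) \<cdot> (x \<cdot> x)"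
  have v: "?v = - (?U + ?U)"
    by (rule mult_yx_x)
  moreover have "- ?v = ?U"
    using mult_xy_x[of y "x \<cdot> x"] by (simp add: mult_y_xx[of y x] mult_linear_simps)
  ultimately have "?U + ?U = ?U"
    by (metis minus_minus)
  then have "?U = 0"
    by simp
  then show "?v = 0"
    using v by simp
  show "y \<cdot> ((x \<cdot> x) \<cdot> y) = 0"
    using mult_x_yx[of y "x \<cdot> x"] \<open>?U = 0\<close> by simp
qed

text \<open>One cubic for each mixed multidegree is enough: the cubes of \<open>a\<close> and
  \<open>b\<close> vanish and the other arrangements are integer multiples of the one listed. Only
  spanning matters, so the entries may coincide or be zero.\<close>

definition two_generator_monomials :: "'a \<Rightarrow> 'a \<Rightarrow> 'a set" where
  "two_generator_monomials a b =
     {a, b, a \<cdot> a, a \<cdot> b, b \<cdot> a, b \<cdot> b, (a \<cdot> a) \<cdot> b, (b \<cdot> b) \<cdot> a}"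

lemmas mult_degree_4 = mult_xxy_x mult_xxy_y

lemma mult_degree_2_2:
  assumes "{p, q, r, s} \<subseteq> {a, b}"
  shows "(p \<cdot> q) \<cdot> (r \<cdot> s) = 0"
proof -
  have pqrs: "p \<in> {a, b}" "q \<in> {a, b}" "r \<in> {a, b}" "s \<in> {a, b}"
    using assms by auto
  \<comment> \<open>The first three letters multiply to zero or to an integer multiple of a listed
    cubic, and each listed cubic is annihilated by both letters.\<close>
  have 1: "((c \<cdot> d) \<cdot> e) \<cdot> f = 0 \<and> (e \<cdot> (c \<cdot> d)) \<cdot> f = 0"
    if "c \<in> {a, b}" "d \<in> {a, b}" "e \<in> {a, b}" "f \<in> {a, b}" for c d e f
    using that
    by (elim insertE emptyE)
      (simp_all add: mult_linear_simps mult_two_variables[of a b] mult_two_variables[of b a]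
        cube_left cube_right mult_degree_4)
  show ?thesis
    \<comment> \<open>With \<open>w = r \<cdot> s\<close> all three premises are products of the
      shape treated in fact \<open>1\<close>.\<close>
    by (rule mult_mult_eq_0) (simp_all only: 1 pqrs)
qed

lemma mult_xxy_monomials:
  assumes "p \<in> two_generator_monomials x y"
  shows "p \<cdot> ((x \<cdot> x) \<cdot> y) = 0" and "((x \<cdot> x) \<cdot> y) \<cdot> p = 0"
proof -
  let ?w = "(x \<cdot> x) \<cdot> y"
  \<comment> \<open>Two-sided annihilation of \<open>?w\<close> passes from factors to their
    product, so it spreads from \<open>x\<close> and \<open>y\<close> to every monomial, including
    \<open>?w\<close> itself.\<close>
  have ann: "(p \<cdot> q) \<cdot> ?w = 0 \<and> ?w \<cdot> (p \<cdot> q) = 0"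
    if "p \<cdot> ?w = 0 \<and> ?w \<cdot> p = 0" "q \<cdot> ?w = 0 \<and> ?w \<cdot> q = 0" for p q
    using that mult_mult_eq_0[of ?w q p] mult_mult_eq_0'[of q p ?w] by simp
  have xy: "x \<cdot> ?w = 0 \<and> ?w \<cdot> x = 0" "y \<cdot> ?w = 0 \<and> ?w \<cdot> y = 0"
    by (simp_all add: mult_degree_4)
  have "p \<cdot> ?w = 0 \<and> ?w \<cdot> p = 0"
    using assms unfolding two_generator_monomials_def
    by (elim insertE emptyE) (simp_all add: ann xy)
  then show "p \<cdot> ?w = 0" "?w \<cdot> p = 0"
    by simp_all
qed

lemma two_generator_monomials_commute: "two_generator_monomials a b = two_generator_monomials b a"
  by (auto simp: two_generator_monomials_def)

lemma cubic_mult_monomials: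
  fixes a b
  defines "B \<equiv> two_generator_monomials a b"
  shows "p \<in> B \<Longrightarrow> p \<cdot> ((a \<cdot> a) \<cdot> b) = 0" "p \<in> B \<Longrightarrow> ((a \<cdot> a) \<cdot> b) \<cdot> p = 0"
    and "p \<in> B \<Longrightarrow> p \<cdot> ((b \<cdot> b) \<cdot> a) = 0" "p \<in> B \<Longrightarrow> ((b \<cdot> b) \<cdot> a) \<cdot> p = 0"
  using mult_xxy_monomials[of p a b] mult_xxy_monomials[of p b a]
  by (simp_all add: B_def two_generator_monomials_commute[of b a])

text \<open>Two letters give a listed product, and a letter with a quadratic gives a multiple of a
  listed cubic or zero. Two quadratics, or a cubic with anything listed, give zero.\<close>

lemma subalgebra_span_monomials: "subalgebra (span (two_generator_monomials a b))"
proof (rule subalgebra_span)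
  fix p q assume "p \<in> two_generator_monomials a b" "q \<in> two_generator_monomials a b"
  then show "p \<cdot> q \<in> span (two_generator_monomials a b)"
    unfolding two_generator_monomials_def
    by (elim insertE emptyE)
      (simp_all add: cubic_mult_monomials[of _ a b] two_generator_monomials_def
        mult_degree_2_2[of _ _ _ _ a b] mult_two_variables[of a b]
        mult_two_variables[of b a] cube_left cube_right
        span_base span_add span_neg span_diff span_zero)
qed

text \<open>If all three arguments are letters, the degree three rules evaluate every term.
  Otherwise every term has degree at least four and is zero.\<close>

lemma symmetric_Zinbiel_monomials: "symmetric_Zinbiel (two_generator_monomials a b)"
  unfolding symmetric_Zinbiel_def
proof (intro ballI)
  fix p q r
  assume "p \<in> two_generator_monomials a b" "q \<in> two_generator_monomials a b"
    "r \<in> two_generator_monomials a b"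
  then show "(p \<cdot> q) \<cdot> r = p \<cdot> (q \<cdot> r) + p \<cdot> (r \<cdot> q) \<and> p \<cdot> (q \<cdot> r) = (p \<cdot> q) \<cdot> r + (q \<cdot> p) \<cdot> r"
    unfolding two_generator_monomials_def
    by (elim insertE emptyE)
      (simp_all add: cubic_mult_monomials[of _ a b] two_generator_monomials_def mult_linear_simps
        mult_degree_2_2[of _ _ _ _ a b] mult_two_variables[of a b]
        mult_two_variables[of b a] cube_left cube_right)
qed

section \<open>The two directions of the equivalence\<close>

lemma binary_symmetric_Zinbiel: binary_symmetric_Zinbiel
  unfolding binary_symmetric_Zinbiel_def binary_def
proof (intro allI)
  fix a b
  have "{a, b} \<subseteq> span (two_generator_monomials a b)"
    by (simp add: span_base two_generator_monomials_def)
  then have "generated_subalgebra {a, b} \<subseteq> span (two_generator_monomials a b)"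
    by (rule generated_subalgebra_minimal[OF _ subalgebra_span_monomials])
  then show "symmetric_Zinbiel (generated_subalgebra {a, b})"
    by (rule symmetric_Zinbiel_subset[OF symmetric_Zinbiel_span
          [OF symmetric_Zinbiel_monomials]])
qed

end

lemma (in complex_algebra) two_variable_ZinbielI:
  assumes binary_symmetric_Zinbiel
  shows "two_variable_Zinbiel scale mult"
proof unfold_locales
  fix x y
  let ?G = "generated_subalgebra {x, y}"
  have "symmetric_Zinbiel ?G"
    using assms by (simp add: binary_symmetric_Zinbiel_def binary_def)
  moreover have "x \<in> ?G" "y \<in> ?G"
    using generated_subalgebra_superset[of "{x, y}"] by auto
  ultimately have Z:
    "(u \<cdot> v) \<cdot> w = u \<cdot> (v \<cdot> w) + u \<cdot> (w \<cdot> v)" "u \<cdot> (v \<cdot> w) = (u \<cdot> v) \<cdot> w + (v \<cdot> u) \<cdot> w"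
    if "{u, v, w} \<subseteq> {x, y}" for u v w
    using that unfolding symmetric_Zinbiel_def by blast+
  show "x \<cdot> (y \<cdot> x) = (x \<cdot> y + y \<cdot> x) \<cdot> x" "x \<cdot> (x \<cdot> y) = scale 2 ((x \<cdot> x) \<cdot> y)"
    using Z(2)[of x y x] Z(2)[of x x y] by (simp_all add: mult_add_left scale_two)
  show "(x \<cdot> y) \<cdot> x = x \<cdot> (y \<cdot> x + x \<cdot> y)" "(y \<cdot> x) \<cdot> x = scale 2 (y \<cdot> (x \<cdot> x))"
    using Z(1)[of x y x] Z(1)[of y x x] by (simp_all add: mult_add_right scale_two)
qed

theorem proposition21:
  fixes scale :: "complex \<Rightarrow> 'a::ab_group_add \<Rightarrow> 'a"
    and mult :: "'a \<Rightarrow> 'a \<Rightarrow> 'a"  (infixl \<open>\<cdot>\<close> 70)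
  assumes "complex_algebra scale mult"
  shows "complex_algebra.binary_symmetric_Zinbiel scale mult \<longleftrightarrow>
    (\<forall>x y.
       x \<cdot> (y \<cdot> x) = (x \<cdot> y + y \<cdot> x) \<cdot> x \<and>
       x \<cdot> (x \<cdot> y) = scale 2 ((x \<cdot> x) \<cdot> y) \<and>
       (x \<cdot> y) \<cdot> x = x \<cdot> (y \<cdot> x + x \<cdot> y) \<and>
       (y \<cdot> x) \<cdot> x = scale 2 (y \<cdot> (x \<cdot> x)))"
proof -
  interpret complex_algebra scale mult
    by (fact assms)
  \<comment> \<open>The locale predicate packages the four identities together with the algebra
    axioms, which hold by assumption.\<close>
  have "binary_symmetric_Zinbiel \<longleftrightarrow> two_variable_Zinbiel scale mult"
    using two_variable_ZinbielI two_variable_Zinbiel.binary_symmetric_Zinbiel by blast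
  then show ?thesis
    using assms by (simp add: two_variable_Zinbiel_def two_variable_Zinbiel_axioms_def) blast
qed

end
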